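(* Let $C$ be a convex subset of a real vector space, $x_1,\dots,x_n\in C$, and $\varphi:C\to\mathbb{R}$ a convex function. Let $\mu=(\mu_1,\dots,\mu_m)$ and $\lambda=(\lambda_1,\dots,\lambda_n)$ be probability vectors, and let $\omega_1,\omega_2$ be two weight functions with respect to $\mu$ and $\lambda$. For $0\le t\le 1$ put $$\phi_{\omega_1,\omega_2}(t)=\sum_{i=1}^m\mu_i\,\varphi\left(\sum_{j=1}^n[(1-t)\omega_1(i,j)+t\omega_2(i,j)]\lambda_jx_j\right).$$ Then: (i) For all $0\le t\le 1$, $$\varphi\left(\sum_{j=1}^n\lambda_jx_j\right)\le \phi_{\omega_1,\omega_2}(t)\le\sum_{j=1}^n\lambda_j\varphi(x_j).$$ (ii) For each $i\in\{1,\dots,m\}$, the function $$t\mapsto\varphi\left(\sum_{j=1}^n[(1-t)\omega_1(i,j)+t\omega_2(i,j)]\lambda_jx_j\right)\qquad(0\le t\le 1)$$ is convex, and so $\phi_{\omega_1,\omega_2}$ is convex on $[0,1]$. (iii) $$\varphi\left(\sum_{j=1}^n\lambda_jx_j\right)\le\int_0^1\phi_{\omega_1,\omega_2}(t)\,dt\le\sum_{j=1}^n\lambda_j\varphi(x_j).$$ In particular, if $C$ is an interval of $\mathbb{R}$, then $$\varphi\left(\sum_{j=1}^n\lambda_jx_j\right)\le\sum_{i=1}^m\mu_i\,A\left(\varphi;\ \sum_{j=1}^n\omega_1(i,j)\lambda_jx_j,\ \sum_{j=1}^n\omega_2(i,j)\lambda_jx_j\right)\le\sum_{j=1}^n\lambda_j\varphi(x_j).$$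 (iv) Let $k\ge 1$, $p_1,\dots,p_k\ge 0$ with $P_k=\sum_{i=1}^kp_i>0$, and $t_1,\dots,t_k\in[0,1]$. Then $$\varphi\left(\sum_{j=1}^n\lambda_jx_j\right)\le\phi_{\omega_1,\omega_2}\left(\frac1{P_k}\sum_{i=1}^kp_it_i\right)\le\frac1{P_k}\sum_{i=1}^kp_i\,\phi_{\omega_1,\omega_2}(t_i)\le\sum_{j=1}^n\lambda_j\varphi(x_j).$$
   Context: $m,n\ge1$ are integers. Probability vectors: $\mu_i\ge0$, $\lambda_j\ge0$, $\sum_{i=1}^m\mu_i=1$, $\sum_{j=1}^n\lambda_j=1$. A weight function with respect to $\mu$ and $\lambda$ is a map $\omega:\{1,\dots,m\}\times\{1,\dots,n\}\to[0,\infty)$ such that $\sum_{i=1}^m\omega(i,j)\mu_i=1$ for every $j=1,\dots,n$ and $\sum_{j=1}^n\omega(i,j)\lambda_j=1$ for every $i=1,\dots,m$. For an integrable function $f$ over an interval with end points $a$ and $b$, the arithmetic mean is $A(f;a,b)=\frac1{b-a}\int_a^bf(x)\,dx$ if $a\ne b$, and $A(f;a,a)=f(a)$. *)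

theory Defs
  imports "HOL-Analysis.Analysis"
begin

text \<open>
  Finite families are functions on \<^typ>\<open>nat\<close> of which only the values at \<open>{1..n}\<close> are relevant.
\<close>

definition prob_vector :: "nat \<Rightarrow> (nat \<Rightarrow> real) \<Rightarrow> bool" where
  "prob_vector n p \<longleftrightarrow> (\<forall>i\<in>{1..n}. 0 \<le> p i) \<and> (\<Sum>i=1..n. p i) = 1"

definition weight_function ::
  "nat \<Rightarrow> nat \<Rightarrow> (nat \<Rightarrow> real) \<Rightarrow> (nat \<Rightarrow> real) \<Rightarrow> (nat \<Rightarrow> nat \<Rightarrow> real) \<Rightarrow> bool" where
  "weight_function m n \<mu> lam \<omega> \<longleftrightarrow>
     (\<forall>i\<in>{1..m}. \<forall>j\<in>{1..n}. 0 \<le> \<omega> i j) \<and>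
     (\<forall>j\<in>{1..n}. (\<Sum>i=1..m. \<omega> i j * \<mu> i) = 1) \<and>
     (\<forall>i\<in>{1..m}. (\<Sum>j=1..n. \<omega> i j * lam j) = 1)"

text \<open>
  The end points of \<open>LBINT x=a..b\<close> may come in either order; for \<open>b < a\<close> the integral is
  minus the one from \<open>b\<close> to \<open>a\<close>.
\<close>

definition arith_mean :: "(real \<Rightarrow> real) \<Rightarrow> real \<Rightarrow> real \<Rightarrow> real" where
  "arith_mean f a b = (if a = b then f a else (1 / (b - a)) * (LBINT x=a..b. f x))"

definition mix_point ::
  "nat \<Rightarrow> (nat \<Rightarrow> real) \<Rightarrow> (nat \<Rightarrow> 'a::real_vector) \<Rightarrow> (nat \<Rightarrow> nat \<Rightarrow> real) \<Rightarrow> (nat \<Rightarrow> nat \<Rightarrow> real)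
    \<Rightarrow> nat \<Rightarrow> real \<Rightarrow> 'a" where
  "mix_point n lam x \<omega>1 \<omega>2 i t =
     (\<Sum>j=1..n. (((1 - t) * \<omega>1 i j + t * \<omega>2 i j) * lam j) *\<^sub>R x j)"

definition phi_mix ::
  "nat \<Rightarrow> nat \<Rightarrow> (nat \<Rightarrow> real) \<Rightarrow> (nat \<Rightarrow> real) \<Rightarrow> (nat \<Rightarrow> 'a::real_vector) \<Rightarrow> ('a \<Rightarrow> real)
    \<Rightarrow> (nat \<Rightarrow> nat \<Rightarrow> real) \<Rightarrow> (nat \<Rightarrow> nat \<Rightarrow> real) \<Rightarrow> real \<Rightarrow> real" where
  "phi_mix m n \<mu> lam x \<phi> \<omega>1 \<omega>2 t = (\<Sum>i=1..m. \<mu> i * \<phi> (mix_point n lam x \<omega>1 \<omega>2 i t))"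

end

theory Submission
  imports Defs
begin

text \<open>
  A weight function splits the point \<open>\<Sum>\<^sub>j \<lambda>\<^sub>j x\<^sub>j\<close> in two stages. Each row
  \<open>j \<mapsto> \<omega>(i,j) \<lambda>\<^sub>j\<close> is a probability vector, so it defines an average \<open>z\<^sub>i\<close> of the \<open>x\<^sub>j\<close>; each
  column \<open>i \<mapsto> \<omega>(i,j) \<mu>\<^sub>i\<close> is one too, so the \<open>\<mu>\<close>-average of the \<open>z\<^sub>i\<close> is again
  \<open>\<Sum>\<^sub>j \<lambda>\<^sub>j x\<^sub>j\<close>. Jensen's inequality over \<open>i\<close> bounds \<open>\<Sum>\<^sub>i \<mu>\<^sub>i \<phi>(z\<^sub>i)\<close> from below, and
  Jensen's inequality in each row bounds it from above (\<open>weight_function_jensen\<close>). As weight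
  functions form a convex set, this holds for every mixture \<open>(1 - t) \<omega>1 + t \<omega>2\<close>, which
  bounds \<open>\<Phi> t\<close> from both sides.

  The row averages are affine in \<open>t\<close>, which makes \<open>\<Phi>\<close> convex; the refinement over parameters
  \<open>s\<^sub>1, \<dots>, s\<^sub>k\<close> is Jensen's inequality for \<open>\<Phi>\<close> together with these bounds. A real convex
  function on a compact interval is bounded, and continuous in the interior, hence integrable, so
  the bounds on \<open>\<Phi>\<close> pass to its integral. On the line, the substitution \<open>u = (1 - t) a + t b\<close>
  identifies the arithmetic mean over the interval between \<open>a\<close> and \<open>b\<close> with an integral over the
  unit interval (\<open>arith_mean_eq_unit_integral\<close>), so \<open>\<integral> \<Phi>\<close> is the \<open>\<mu>\<close>-average of the arithmetic
  means.
\<close>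

section \<open>Weight functions and Jensen's inequality\<close>

lemma weight_function_mix:
  assumes "weight_function m n \<mu> lam \<omega>1" "weight_function m n \<mu> lam \<omega>2" "t \<in> {0..1}"
  shows "weight_function m n \<mu> lam (\<lambda>i j. (1 - t) * \<omega>1 i j + t * \<omega>2 i j)"
proof -
  have "(\<Sum>i\<in>S. ((1 - t) * f i + t * g i) * h i)
      = (1 - t) * (\<Sum>i\<in>S. f i * h i) + t * (\<Sum>i\<in>S. g i * h i)" for S :: "nat set" and f g h
    by (simp add: sum_distrib_left sum.distrib algebra_simps sum_subtractf)
  then show ?thesis
    using assms by (auto simp: weight_function_def)
qed

lemma weight_function_row:
  assumes "prob_vector n lam" "weight_function m n \<mu> lam \<omega>" "i \<in> {1..m}"
  shows "prob_vector n (\<lambda>j. \<omega> i j * lam j)"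
  using assms by (auto simp: prob_vector_def weight_function_def)

lemma prob_vector_average_in_convex:
  assumes "prob_vector n p" "convex C" "\<forall>j\<in>{1..n}. x j \<in> C"
  shows "(\<Sum>j=1..n. p j *\<^sub>R x j) \<in> C"
  using assms by (intro convex_sum) (auto simp: prob_vector_def)

lemma prob_vector_jensen:
  fixes x :: "nat \<Rightarrow> 'a::real_vector"
  assumes "prob_vector n p" "convex_on C \<phi>" "\<forall>j\<in>{1..n}. x j \<in> C"
  shows "\<phi> (\<Sum>j=1..n. p j *\<^sub>R x j) \<le> (\<Sum>j=1..n. p j * \<phi> (x j))"
proof (rule convex_on_sum[OF _ _ assms(2)])
  show "{1..n} \<noteq> {}"
    using assms(1) by (cases n) (auto simp: prob_vector_def)
qed (use assms in \<open>auto simp: prob_vector_def\<close>)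

text \<open>
  The \<open>\<mu>\<close>-weighted sum of each column of \<open>\<omega>\<close> is \<open>1\<close>, so summing over \<open>i\<close> first removes
  \<open>\<omega>\<close>. Both Jensen bounds below rest on this identity: the lower one with \<open>v\<close> the points \<open>x\<^sub>j\<close>, the
  upper one with \<open>v\<close> the values \<open>\<phi>(x\<^sub>j)\<close>.
\<close>

lemma weight_function_average:
  fixes v :: "nat \<Rightarrow> 'a::real_vector"
  assumes "weight_function m n \<mu> lam \<omega>"
  shows "(\<Sum>i=1..m. \<mu> i *\<^sub>R (\<Sum>j=1..n. (\<omega> i j * lam j) *\<^sub>R v j)) = (\<Sum>j=1..n. lam j *\<^sub>R v j)"
proof -
  have "(\<Sum>i=1..m. \<mu> i *\<^sub>R (\<Sum>j=1..n. (\<omega> i j * lam j) *\<^sub>R v j))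
      = (\<Sum>j=1..n. \<Sum>i=1..m. (\<omega> i j * \<mu> i * lam j) *\<^sub>R v j)"
    by (subst sum.swap) (simp add: scaleR_sum_right mult_ac)
  also have "\<dots> = (\<Sum>j=1..n. ((\<Sum>i=1..m. \<omega> i j * \<mu> i) * lam j) *\<^sub>R v j)"
    by (simp add: scaleR_sum_left sum_distrib_right)
  also have "\<dots> = (\<Sum>j=1..n. lam j *\<^sub>R v j)"
    using assms by (intro sum.cong) (auto simp: weight_function_def)
  finally show ?thesis .
qed

lemma weight_function_jensen:
  fixes x :: "nat \<Rightarrow> 'a::real_vector"
  assumes C: "convex C" "\<forall>j\<in>{1..n}. x j \<in> C" "convex_on C \<phi>"
    and \<mu>: "prob_vector m \<mu>" and lam: "prob_vector n lam"
    and \<omega>: "weight_function m n \<mu> lam \<omega>"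
  shows "\<phi> (\<Sum>j=1..n. lam j *\<^sub>R x j) \<le> (\<Sum>i=1..m. \<mu> i * \<phi> (\<Sum>j=1..n. (\<omega> i j * lam j) *\<^sub>R x j))"
    and "(\<Sum>i=1..m. \<mu> i * \<phi> (\<Sum>j=1..n. (\<omega> i j * lam j) *\<^sub>R x j)) \<le> (\<Sum>j=1..n. lam j * \<phi> (x j))"
proof -
  define z where "z i = (\<Sum>j=1..n. (\<omega> i j * lam j) *\<^sub>R x j)" for i
  have row: "prob_vector n (\<lambda>j. \<omega> i j * lam j)" if "i \<in> {1..m}" for i
    using weight_function_row[OF lam \<omega> that] .
  have "z i \<in> C" if "i \<in> {1..m}" for i
    unfolding z_def using prob_vector_average_in_convex[OF row[OF that] C(1,2)] .
  then have "\<phi> (\<Sum>i=1..m. \<mu> i *\<^sub>R z i) \<le> (\<Sum>i=1..m. \<mu> i * \<phi> (z i))"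
    using prob_vector_jensen[OF \<mu> C(3)] by blast
  then show "\<phi> (\<Sum>j=1..n. lam j *\<^sub>R x j) \<le> (\<Sum>i=1..m. \<mu> i * \<phi> (\<Sum>j=1..n. (\<omega> i j * lam j) *\<^sub>R x j))"
    unfolding z_def weight_function_average[OF \<omega>] .
  have "(\<Sum>i=1..m. \<mu> i * \<phi> (z i)) \<le> (\<Sum>i=1..m. \<mu> i * (\<Sum>j=1..n. \<omega> i j * lam j * \<phi> (x j)))"
    using \<mu> prob_vector_jensen[OF row C(3,2)]
    by (intro sum_mono mult_left_mono) (auto simp: prob_vector_def z_def)
  also have "\<dots> = (\<Sum>j=1..n. lam j * \<phi> (x j))"
    using weight_function_average[OF \<omega>, of "\<lambda>j. \<phi> (x j)"] by simp
  finally show "(\<Sum>i=1..m. \<mu> i * \<phi> (\<Sum>j=1..n. (\<omega> i j * lam j) *\<^sub>R x j)) \<le> (\<Sum>j=1..n. lam j * \<phi> (x j))"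
    unfolding z_def .
qed

section \<open>Convexity in the mixing parameter\<close>

lemma mix_point_affine:
  "mix_point n lam x \<omega>1 \<omega>2 i t
    = (1 - t) *\<^sub>R mix_point n lam x \<omega>1 \<omega>2 i 0 + t *\<^sub>R mix_point n lam x \<omega>1 \<omega>2 i 1"
  by (simp add: mix_point_def scaleR_sum_right sum.distrib[symmetric] scaleR_add_left[symmetric]
      distrib_right mult.assoc)

lemma convex_on_affine_path:
  fixes a b :: "'a::real_vector"
  assumes "convex_on C \<phi>" "a \<in> C" "b \<in> C"
  shows "convex_on {0..1} (\<lambda>t. \<phi> ((1 - t) *\<^sub>R a + t *\<^sub>R b))"
proof (rule convex_onI)
  fix u s t :: real
  assume u: "0 < u" "u < 1" and st: "s \<in> {0..1}" "t \<in> {0..1}"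
  have path: "(1 - r) *\<^sub>R a + r *\<^sub>R b \<in> C" if "r \<in> {0..1}" for r
    using assms that by (auto intro!: convexD simp: convex_on_def)
  have "(1 - ((1 - u) *\<^sub>R s + u *\<^sub>R t)) *\<^sub>R a + ((1 - u) *\<^sub>R s + u *\<^sub>R t) *\<^sub>R b
      = (1 - u) *\<^sub>R ((1 - s) *\<^sub>R a + s *\<^sub>R b) + u *\<^sub>R ((1 - t) *\<^sub>R a + t *\<^sub>R b)"
    by (simp add: algebra_simps)
  then show "\<phi> ((1 - ((1 - u) *\<^sub>R s + u *\<^sub>R t)) *\<^sub>R a + ((1 - u) *\<^sub>R s + u *\<^sub>R t) *\<^sub>R b)
      \<le> (1 - u) * \<phi> ((1 - s) *\<^sub>R a + s *\<^sub>R b) + u * \<phi> ((1 - t) *\<^sub>R a + t *\<^sub>R b)"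
    using convex_onD[OF assms(1), of u] u path st by auto
qed simp

lemma mix_point_in_convex:
  assumes "convex C" "\<forall>j\<in>{1..n}. x j \<in> C" "prob_vector n lam"
    and "weight_function m n \<mu> lam \<omega>1" "weight_function m n \<mu> lam \<omega>2"
    and "i \<in> {1..m}" "t \<in> {0..1}"
  shows "mix_point n lam x \<omega>1 \<omega>2 i t \<in> C"
  unfolding mix_point_def
  using weight_function_row[OF assms(3) weight_function_mix[OF assms(4,5,7)] assms(6)] assms(1,2)
  by (rule prob_vector_average_in_convex)

lemma convex_on_mix_point:
  fixes x :: "nat \<Rightarrow> 'a::real_vector"
  assumes "convex C" "\<forall>j\<in>{1..n}. x j \<in> C" "convex_on C \<phi>" "prob_vector n lam"
    and "weight_function m n \<mu> lam \<omega>1" "weight_function m n \<mu> lam \<omega>2"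
    and "i \<in> {1..m}"
  shows "convex_on {0..1} (\<lambda>t. \<phi> (mix_point n lam x \<omega>1 \<omega>2 i t))"
proof -
  have "mix_point n lam x \<omega>1 \<omega>2 i t \<in> C" if "t \<in> {0..1}" for t
    using mix_point_in_convex[OF assms(1,2,4-7) that] .
  then have "convex_on {0..1} (\<lambda>t. \<phi> ((1 - t) *\<^sub>R mix_point n lam x \<omega>1 \<omega>2 i 0
      + t *\<^sub>R mix_point n lam x \<omega>1 \<omega>2 i 1))"
    by (intro convex_on_affine_path[OF assms(3)]) auto
  then show ?thesis
    by (simp flip: mix_point_affine)
qed

lemma convex_on_finite_sum:
  assumes "\<And>i. i \<in> S \<Longrightarrow> convex_on A (f i)" "convex A"
  shows "convex_on A (\<lambda>t. \<Sum>i\<in>S. f i t)"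
  using assms
proof (induction S rule: infinite_finite_induct)
  case (insert i S)
  then show ?case by (simp add: convex_on_add)
qed (auto simp: convex_on_def)

lemma convex_on_phi_mix:
  fixes x :: "nat \<Rightarrow> 'a::real_vector"
  assumes "convex C" "\<forall>j\<in>{1..n}. x j \<in> C" "convex_on C \<phi>" "prob_vector m \<mu>" "prob_vector n lam"
    and "weight_function m n \<mu> lam \<omega>1" "weight_function m n \<mu> lam \<omega>2"
  shows "convex_on {0..1} (phi_mix m n \<mu> lam x \<phi> \<omega>1 \<omega>2)"
  unfolding phi_mix_def
  using convex_on_mix_point[OF assms(1-3,5-7)] assms(4)
  by (intro convex_on_finite_sum convex_on_cmul) (auto simp: prob_vector_def)

lemma phi_mix_bounds:
  fixes x :: "nat \<Rightarrow> 'a::real_vector"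
  assumes "convex C" "\<forall>j\<in>{1..n}. x j \<in> C" "convex_on C \<phi>" "prob_vector m \<mu>" "prob_vector n lam"
    and "weight_function m n \<mu> lam \<omega>1" "weight_function m n \<mu> lam \<omega>2"
    and "t \<in> {0..1}"
  shows "\<phi> (\<Sum>j=1..n. lam j *\<^sub>R x j) \<le> phi_mix m n \<mu> lam x \<phi> \<omega>1 \<omega>2 t"
    and "phi_mix m n \<mu> lam x \<phi> \<omega>1 \<omega>2 t \<le> (\<Sum>j=1..n. lam j * \<phi> (x j))"
  unfolding phi_mix_def mix_point_def
  using weight_function_jensen[OF assms(1-5) weight_function_mix[OF assms(6-8)]] by auto

section \<open>Integrals of convex functions\<close>

text \<open>
  The reflection of \<open>c\<close> in the midpoint \<open>(a + b) / 2\<close> turns the upper bound \<open>max (f a) (f b)\<close> into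
  a lower bound, as \<open>f\<close> at the midpoint is at most the mean of its values at
  \<open>c\<close> and at \<open>a + b - c\<close>.
\<close>

lemma convex_on_Icc_lower_bound:
  fixes f :: "real \<Rightarrow> real"
  assumes f: "convex_on {a..b} f" and c: "c \<in> {a..b}"
  shows "2 * f ((a + b) / 2) - max (f a) (f b) \<le> f c"
proof -
  have r: "a + b - c \<in> {a..b}"
    using c by auto
  have mid: "(1 - 1/2) *\<^sub>R c + (1/2) *\<^sub>R (a + b - c) = (a + b) / 2"
    by (simp add: field_simps)
  have "f ((1 - 1/2) *\<^sub>R c + (1/2) *\<^sub>R (a + b - c)) \<le> (1 - 1/2) * f c + (1/2) * f (a + b - c)"
    by (rule convex_onD[OF f _ _ c r]) auto
  then have "f ((a + b) / 2) \<le> (1 - 1/2) * f c + (1/2) * f (a + b - c)"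
    unfolding mid .
  then show ?thesis
    using convex_on_le_max[OF f r] by simp
qed

text \<open>
  At the end points a convex function may jump, so continuity holds only on the open
  interval; that is the set over which \<open>LBINT x=a..b\<close> integrates. The two-sided bound then gives
  integrability.
\<close>

lemma convex_on_Icc_integrable:
  fixes f :: "real \<Rightarrow> real"
  assumes f: "convex_on {a..b} f" and "a \<le> b"
  shows "interval_lebesgue_integrable lborel a b f"
proof -
  define B where "B = \<bar>max (f a) (f b)\<bar> + \<bar>2 * f ((a + b) / 2) - max (f a) (f b)\<bar>"
  have "convex_on {a<..<b} f"
    by (rule convex_on_subset[OF f]) auto
  then have cont: "continuous_on {a<..<b} f"
    by (intro convex_on_continuous) auto
  have "set_integrable lborel {a<..<b} f"
  proof (rule set_integrable_bound)
    show "set_integrable lborel {a<..<b} (\<lambda>_. B)"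
      using assms(2) by (simp add: set_integrable_def)
    show "set_borel_measurable lborel {a<..<b} f"
      using borel_measurable_continuous_on_indicator[OF _ cont]
      by (simp add: set_borel_measurable_def)
    have "\<bar>f c\<bar> \<le> \<bar>B\<bar>" if "c \<in> {a<..<b}" for c
      using convex_on_Icc_lower_bound[OF f, of c] convex_on_le_max[OF f, of c] that
      unfolding B_def by auto
    then show "AE c in lborel. c \<in> {a<..<b} \<longrightarrow> norm (f c) \<le> norm B"
      by simp
  qed
  then show ?thesis
    using assms(2) by (simp add: interval_lebesgue_integrable_def)
qed

lemma convex_on_interval_integrable:
  fixes f :: "real \<Rightarrow> real"
  assumes "convex_on D f" "a \<in> D" "b \<in> D"
  shows "interval_lebesgue_integrable lborel a b f"
proof -
  have main: "interval_lebesgue_integrable lborel c d f" if "c \<in> D" "d \<in> D" "c \<le> d" for c d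
  proof (rule convex_on_Icc_integrable[OF _ that(3)])
    have "{c..d} \<subseteq> D"
      using closed_segment_subset[OF that(1,2)] assms(1) that(3)
      by (simp add: convex_on_def closed_segment_eq_real_ivl)
    then show "convex_on {c..d} f"
      using convex_on_subset[OF assms(1)] by simp
  qed
  show ?thesis
    using main[of a b] main[of b a] assms(2,3) interval_integrable_endpoints_reverse[of a b f]
    by linarith
qed

lemma unit_interval_integral_bounds:
  fixes f :: "real \<Rightarrow> real"
  assumes f: "interval_lebesgue_integrable lborel 0 1 f"
    and bounds: "\<And>t. t \<in> {0..1} \<Longrightarrow> L \<le> f t" "\<And>t. t \<in> {0..1} \<Longrightarrow> f t \<le> U"
  shows "L \<le> (LBINT t=0..1. f t)" "(LBINT t=0..1. f t) \<le> U"
proof -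
  have unit: "einterval 0 1 = {0<..<1}"
    by (auto simp: einterval_def)
  have int: "set_integrable lborel {0<..<1} f" "set_integrable lborel {0<..<1::real} (\<lambda>_. c)" for c :: real
    using f interval_integral_const(1)[of 0 1 c] by (simp_all add: interval_lebesgue_integrable_def unit)
  have const: "(LINT t:{0<..<1::real}|lborel. c) = c" for c :: real
    by (subst set_integral_const) auto
  have eq: "(LBINT t=0..1. f t) = (LINT t:{0<..<1}|lborel. f t)"
    by (simp add: interval_lebesgue_integral_def unit)
  have "(LINT t:{0<..<1::real}|lborel. L) \<le> (LINT t:{0<..<1}|lborel. f t)"
    using bounds(1) by (intro set_integral_mono int) auto
  then show "L \<le> (LBINT t=0..1. f t)"
    by (simp only: eq const)
  have "(LINT t:{0<..<1}|lborel. f t) \<le> (LINT t:{0<..<1::real}|lborel. U)"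
    using bounds(2) by (intro set_integral_mono int) auto
  then show "(LBINT t=0..1. f t) \<le> U"
    by (simp only: eq const)
qed

lemma interval_integral_finite_sum:
  fixes f :: "'i \<Rightarrow> real \<Rightarrow> real"
  assumes "\<And>i. i \<in> S \<Longrightarrow> interval_lebesgue_integrable lborel a b (f i)"
  shows "interval_lebesgue_integrable lborel a b (\<lambda>t. \<Sum>i\<in>S. f i t)
    \<and> (LBINT t=a..b. (\<Sum>i\<in>S. f i t)) = (\<Sum>i\<in>S. LBINT t=a..b. f i t)"
  using assms
proof (induction S rule: infinite_finite_induct)
  case (insert i S)
  then show ?case by simp
qed (auto simp: interval_lebesgue_integrable_def set_integrable_def)

text \<open>
  This is the substitution \<open>u = a + (b - a) t\<close>. It is valid for every \<open>f\<close>: an affine change of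
  variable preserves integrability both ways, and a non-integrable function has integral \<open>0\<close> on both
  sides. For \<open>b < a\<close> the sign of the oriented integral cancels the sign of \<open>b - a\<close>, and for
  \<open>a = b\<close> both sides are \<open>f a\<close>.
\<close>

lemma arith_mean_eq_unit_integral:
  "arith_mean f a b = (LBINT t=0..1. f ((1 - t) * a + t * b))"
proof -
  have unit: "einterval 0 1 = {0<..<1}"
    by (auto simp: einterval_def)
  have rhs: "(LBINT t=0..1. g t) = (\<integral>t. indicator {0<..<1} t * g t \<partial>lborel)" for g :: "real \<Rightarrow> real"
    by (simp add: interval_lebesgue_integral_def set_lebesgue_integral_def unit)
  consider "a = b" | "a < b" | "b < a" by linarith
  then show ?thesis
  proof cases
    case 1
    have "(1 - t) * b + t * b = b" for t
      by (simp add: algebra_simps)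
    with 1 show ?thesis
      using interval_integral_const(2)[of 0 1 "f b"]
      by (simp add: arith_mean_def zero_ereal_def one_ereal_def)
  next
    case 2
    have ind: "indicator {a<..<b} (a + (b - a) * t) = (indicator {0<..<1} t :: real)" for t
    proof -
      have "a + (b - a) * t < b \<longleftrightarrow> (b - a) * t < (b - a) * 1"
        by (simp only: mult_1_right) linarith
      also have "\<dots> \<longleftrightarrow> t < 1"
        using 2 by (subst mult_less_cancel_left_pos) auto
      finally show ?thesis
        using 2 by (auto simp: indicator_def zero_less_mult_iff)
    qed
    have "(LBINT x=a..b. f x) = (\<integral>x. indicator {a<..<b} x * f x \<partial>lborel)"
      using 2 by (simp add: interval_lebesgue_integral_def set_lebesgue_integral_def)
    also have "\<dots> = \<bar>b - a\<bar> *\<^sub>R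
        (\<integral>t. indicator {a<..<b} (a + (b - a) * t) * f (a + (b - a) * t) \<partial>lborel)"
      using 2 by (intro lborel_integral_real_affine) simp
    also have "\<dots> = (b - a) * (LBINT t=0..1. f ((1 - t) * a + t * b))"
      using 2 unfolding rhs ind by (simp add: algebra_simps)
    finally show ?thesis
      using 2 by (simp add: arith_mean_def)
  next
    case 3
    have ind: "indicator {b<..<a} (a + (b - a) * t) = (indicator {0<..<1} t :: real)" for t
    proof -
      have "b < a + (b - a) * t \<longleftrightarrow> (b - a) * 1 < (b - a) * t"
        by (simp only: mult_1_right) linarith
      also have "\<dots> \<longleftrightarrow> t < 1"
        using 3 by (subst mult_less_cancel_left_neg) auto
      finally show ?thesis
        using 3 by (auto simp: indicator_def mult_less_0_iff)
    qed
    have "(LBINT x=a..b. f x) = - (\<integral>x. indicator {b<..<a} x * f x \<partial>lborel)"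
      using 3 by (simp add: interval_lebesgue_integral_def set_lebesgue_integral_def)
    also have "(\<integral>x. indicator {b<..<a} x * f x \<partial>lborel) = \<bar>b - a\<bar> *\<^sub>R
        (\<integral>t. indicator {b<..<a} (a + (b - a) * t) * f (a + (b - a) * t) \<partial>lborel)"
      using 3 by (intro lborel_integral_real_affine) simp
    also have "\<dots> = (a - b) * (LBINT t=0..1. f ((1 - t) * a + t * b))"
      using 3 unfolding rhs ind by (simp add: algebra_simps)
    also have "- \<dots> = (b - a) * (LBINT t=0..1. f ((1 - t) * a + t * b))"
      by (simp add: algebra_simps)
    finally show ?thesis
      using 3 by (simp add: arith_mean_def)
  qed
qed

lemma phi_mix_integrable:
  fixes x :: "nat \<Rightarrow> 'a::real_vector"
  assumes "convex C" "\<forall>j\<in>{1..n}. x j \<in> C" "convex_on C \<phi>" "prob_vector m \<mu>" "prob_vector n lam"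
    and "weight_function m n \<mu> lam \<omega>1" "weight_function m n \<mu> lam \<omega>2"
  shows "interval_lebesgue_integrable lborel 0 1 (phi_mix m n \<mu> lam x \<phi> \<omega>1 \<omega>2)"
  using convex_on_Icc_integrable[OF convex_on_phi_mix[OF assms]]
  by (simp add: zero_ereal_def one_ereal_def)

lemma phi_mix_integral_bounds:
  fixes x :: "nat \<Rightarrow> 'a::real_vector"
  assumes "convex C" "\<forall>j\<in>{1..n}. x j \<in> C" "convex_on C \<phi>" "prob_vector m \<mu>" "prob_vector n lam"
    and "weight_function m n \<mu> lam \<omega>1" "weight_function m n \<mu> lam \<omega>2"
  shows "\<phi> (\<Sum>j=1..n. lam j *\<^sub>R x j) \<le> (LBINT t=0..1. phi_mix m n \<mu> lam x \<phi> \<omega>1 \<omega>2 t)"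
    and "(LBINT t=0..1. phi_mix m n \<mu> lam x \<phi> \<omega>1 \<omega>2 t) \<le> (\<Sum>j=1..n. lam j * \<phi> (x j))"
  using unit_interval_integral_bounds[OF phi_mix_integrable[OF assms] phi_mix_bounds[OF assms]]
  by auto

lemma phi_mix_integral_eq_arith_means:
  fixes y :: "nat \<Rightarrow> real"
  assumes "convex D" "\<forall>j\<in>{1..n}. y j \<in> D" "convex_on D \<psi>" "prob_vector n lam"
    and "weight_function m n \<mu> lam \<omega>1" "weight_function m n \<mu> lam \<omega>2"
  shows "(LBINT t=0..1. phi_mix m n \<mu> lam y \<psi> \<omega>1 \<omega>2 t)
    = (\<Sum>i=1..m. \<mu> i * arith_mean \<psi> (\<Sum>j=1..n. \<omega>1 i j * lam j * y j) (\<Sum>j=1..n. \<omega>2 i j * lam j * y j))"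
proof -
  have int: "interval_lebesgue_integrable lborel 0 1 (\<lambda>t. \<psi> (mix_point n lam y \<omega>1 \<omega>2 i t))"
    if "i \<in> {1..m}" for i
    using convex_on_Icc_integrable[OF convex_on_mix_point[OF assms that]]
    by (simp add: zero_ereal_def one_ereal_def)
  have "(LBINT t=0..1. phi_mix m n \<mu> lam y \<psi> \<omega>1 \<omega>2 t)
      = (\<Sum>i=1..m. LBINT t=0..1. \<mu> i * \<psi> (mix_point n lam y \<omega>1 \<omega>2 i t))"
    unfolding phi_mix_def using int by (intro interval_integral_finite_sum[THEN conjunct2]) simp
  also have "\<dots> = (\<Sum>i=1..m. \<mu> i * arith_mean \<psi> (mix_point n lam y \<omega>1 \<omega>2 i 0) (mix_point n lam y \<omega>1 \<omega>2 i 1))"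
    unfolding arith_mean_eq_unit_integral
    by (subst mix_point_affine) simp
  finally show ?thesis
    by (simp add: mix_point_def)
qed

section \<open>The refinement of Jensen's inequality\<close>

text \<open>
  Normalised by \<open>P\<close>, the \<open>p\<^sub>i\<close> form a probability vector. The middle inequality is Jensen's for
  \<open>F\<close>; the outer two are the pointwise bounds at the averaged parameter and at each \<open>s\<^sub>i\<close>.
\<close>

lemma convex_on_weighted_mean_between:
  fixes F :: "real \<Rightarrow> real" and p s :: "nat \<Rightarrow> real"
  assumes F: "convex_on {0..1} F"
    and bounds: "\<And>t. t \<in> {0..1} \<Longrightarrow> L \<le> F t" "\<And>t. t \<in> {0..1} \<Longrightarrow> F t \<le> U"
    and p: "\<forall>i\<in>{1..k}. 0 \<le> p i" "(\<Sum>i=1..k. p i) > 0" and s: "\<forall>i\<in>{1..k}. s i \<in> {0..1}"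
  defines "P \<equiv> \<Sum>i=1..k. p i"
  shows "L \<le> F ((1 / P) * (\<Sum>i=1..k. p i * s i))"
    and "F ((1 / P) * (\<Sum>i=1..k. p i * s i)) \<le> (1 / P) * (\<Sum>i=1..k. p i * F (s i))"
    and "(1 / P) * (\<Sum>i=1..k. p i * F (s i)) \<le> U"
proof -
  have q: "prob_vector k (\<lambda>i. p i / P)"
    using p by (auto simp: prob_vector_def P_def simp flip: sum_divide_distrib)
  have mean: "(1 / P) * (\<Sum>i=1..k. p i * g i) = (\<Sum>i=1..k. (p i / P) *\<^sub>R g i)" for g :: "nat \<Rightarrow> real"
    by (simp add: sum_distrib_left)
  show "L \<le> F ((1 / P) * (\<Sum>i=1..k. p i * s i))"
    unfolding mean using prob_vector_average_in_convex[OF q _ s] by (intro bounds) auto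
  show "F ((1 / P) * (\<Sum>i=1..k. p i * s i)) \<le> (1 / P) * (\<Sum>i=1..k. p i * F (s i))"
    unfolding mean using prob_vector_jensen[OF q F s] by simp
  have "(\<Sum>i=1..k. p i * F (s i)) \<le> (\<Sum>i=1..k. p i * U)"
    using p s bounds(2) by (intro sum_mono mult_left_mono) auto
  also have "\<dots> = P * U"
    by (simp add: P_def sum_distrib_right)
  finally show "(1 / P) * (\<Sum>i=1..k. p i * F (s i)) \<le> U"
    using p(2) by (simp add: P_def field_simps)
qed

theorem theorem2p2:
  fixes m n :: nat
    and C :: "'a::real_vector set"
    and x :: "nat \<Rightarrow> 'a"
    and \<phi> :: "'a \<Rightarrow> real"
    and \<mu> lam :: "nat \<Rightarrow> real"
    and \<omega>1 \<omega>2 :: "nat \<Rightarrow> nat \<Rightarrow> real"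
  assumes "m \<ge> 1" and "n \<ge> 1"
    and "convex C"
    and "\<forall>j\<in>{1..n}. x j \<in> C"
    and "convex_on C \<phi>"
    and "prob_vector m \<mu>"
    and "prob_vector n lam"
    and "weight_function m n \<mu> lam \<omega>1"
    and "weight_function m n \<mu> lam \<omega>2"
  defines "\<Phi> \<equiv> phi_mix m n \<mu> lam x \<phi> \<omega>1 \<omega>2"
  shows
    "(\<forall>t\<in>{0..1}.
        \<phi> (\<Sum>j=1..n. lam j *\<^sub>R x j) \<le> \<Phi> t \<and> \<Phi> t \<le> (\<Sum>j=1..n. lam j * \<phi> (x j)))
     \<and>
     (\<forall>i\<in>{1..m}. convex_on {0..1} (\<lambda>t. \<phi> (mix_point n lam x \<omega>1 \<omega>2 i t))) \<and>
     convex_on {0..1} \<Phi>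
     \<and>
     interval_lebesgue_integrable lborel 0 1 \<Phi> \<and>
     \<phi> (\<Sum>j=1..n. lam j *\<^sub>R x j) \<le> (LBINT t=0..1. \<Phi> t) \<and>
     (LBINT t=0..1. \<Phi> t) \<le> (\<Sum>j=1..n. lam j * \<phi> (x j))
     \<and>
     (\<forall>(D :: real set) (y :: nat \<Rightarrow> real) (\<psi> :: real \<Rightarrow> real).
        is_interval D \<longrightarrow> (\<forall>j\<in>{1..n}. y j \<in> D) \<longrightarrow> convex_on D \<psi> \<longrightarrow>
        (\<forall>i\<in>{1..m}. interval_lebesgue_integrable lborel
            (ereal (\<Sum>j=1..n. \<omega>1 i j * lam j * y j)) (ereal (\<Sum>j=1..n. \<omega>2 i j * lam j * y j)) \<psi>) \<and>
        \<psi> (\<Sum>j=1..n. lam j * y j)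
          \<le> (\<Sum>i=1..m. \<mu> i * arith_mean \<psi> (\<Sum>j=1..n. \<omega>1 i j * lam j * y j)
                                               (\<Sum>j=1..n. \<omega>2 i j * lam j * y j)) \<and>
        (\<Sum>i=1..m. \<mu> i * arith_mean \<psi> (\<Sum>j=1..n. \<omega>1 i j * lam j * y j)
                                             (\<Sum>j=1..n. \<omega>2 i j * lam j * y j))
          \<le> (\<Sum>j=1..n. lam j * \<psi> (y j)))
     \<and>
     (\<forall>(k :: nat) (p :: nat \<Rightarrow> real) (s :: nat \<Rightarrow> real).
        k \<ge> 1 \<longrightarrow> (\<forall>i\<in>{1..k}. 0 \<le> p i) \<longrightarrow> (\<Sum>i=1..k. p i) > 0 \<longrightarrow> (\<forall>i\<in>{1..k}. s i \<in> {0..1}) \<longrightarrow>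
        \<phi> (\<Sum>j=1..n. lam j *\<^sub>R x j)
          \<le> \<Phi> ((1 / (\<Sum>i=1..k. p i)) * (\<Sum>i=1..k. p i * s i)) \<and>
        \<Phi> ((1 / (\<Sum>i=1..k. p i)) * (\<Sum>i=1..k. p i * s i))
          \<le> (1 / (\<Sum>i=1..k. p i)) * (\<Sum>i=1..k. p i * \<Phi> (s i)) \<and>
        (1 / (\<Sum>i=1..k. p i)) * (\<Sum>i=1..k. p i * \<Phi> (s i))
          \<le> (\<Sum>j=1..n. lam j * \<phi> (x j)))"
proof (intro conjI allI impI)
  note vec = assms(3-9)
  note bounds = phi_mix_bounds[OF vec, folded \<Phi>_def]
  show "\<forall>t\<in>{0..1}. \<phi> (\<Sum>j=1..n. lam j *\<^sub>R x j) \<le> \<Phi> t \<and> \<Phi> t \<le> (\<Sum>j=1..n. lam j * \<phi> (x j))"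
    using bounds by blast
  show "\<forall>i\<in>{1..m}. convex_on {0..1} (\<lambda>t. \<phi> (mix_point n lam x \<omega>1 \<omega>2 i t))"
    using convex_on_mix_point[OF assms(3-5,7-9)] by blast
  show conv: "convex_on {0..1} \<Phi>"
    unfolding \<Phi>_def using convex_on_phi_mix[OF vec] .
  show "interval_lebesgue_integrable lborel 0 1 \<Phi>"
    unfolding \<Phi>_def using phi_mix_integrable[OF vec] .
  show "\<phi> (\<Sum>j=1..n. lam j *\<^sub>R x j) \<le> (LBINT t=0..1. \<Phi> t)"
    and "(LBINT t=0..1. \<Phi> t) \<le> (\<Sum>j=1..n. lam j * \<phi> (x j))"
    unfolding \<Phi>_def using phi_mix_integral_bounds[OF vec] .
  {
    fix D :: "real set" and y :: "nat \<Rightarrow> real" and \<psi> :: "real \<Rightarrow> real"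
    assume "is_interval D" and y: "\<forall>j\<in>{1..n}. y j \<in> D" and \<psi>: "convex_on D \<psi>"
    then have D: "convex D"
      by (simp add: is_interval_convex)
    have ends: "(\<Sum>j=1..n. \<omega> i j * lam j * y j) \<in> D"
      if "weight_function m n \<mu> lam \<omega>" "i \<in> {1..m}" for \<omega> i
      using prob_vector_average_in_convex[OF weight_function_row[OF assms(7) that] D y] by simp
    show "\<forall>i\<in>{1..m}. interval_lebesgue_integrable lborel
        (ereal (\<Sum>j=1..n. \<omega>1 i j * lam j * y j)) (ereal (\<Sum>j=1..n. \<omega>2 i j * lam j * y j)) \<psi>"
      using convex_on_interval_integrable[OF \<psi>] ends assms(8,9) by blast
    note means = phi_mix_integral_bounds[OF D y \<psi> assms(6-9),
        unfolded phi_mix_integral_eq_arith_means[OF D y \<psi> assms(7-9)]]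
    show "\<psi> (\<Sum>j=1..n. lam j * y j)
        \<le> (\<Sum>i=1..m. \<mu> i * arith_mean \<psi> (\<Sum>j=1..n. \<omega>1 i j * lam j * y j)
                                             (\<Sum>j=1..n. \<omega>2 i j * lam j * y j))"
      using means(1) by simp
    show "(\<Sum>i=1..m. \<mu> i * arith_mean \<psi> (\<Sum>j=1..n. \<omega>1 i j * lam j * y j)
                                           (\<Sum>j=1..n. \<omega>2 i j * lam j * y j))
        \<le> (\<Sum>j=1..n. lam j * \<psi> (y j))"
      using means(2) .
  next
    fix k :: nat and p s :: "nat \<Rightarrow> real"
    assume "\<forall>i\<in>{1..k}. 0 \<le> p i" "(\<Sum>i=1..k. p i) > 0" "\<forall>i\<in>{1..k}. s i \<in> {0..1}"
    note mean = convex_on_weighted_mean_between[OF conv bounds this]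
    show "\<phi> (\<Sum>j=1..n. lam j *\<^sub>R x j) \<le> \<Phi> ((1 / (\<Sum>i=1..k. p i)) * (\<Sum>i=1..k. p i * s i))"
      using mean(1) .
    show "\<Phi> ((1 / (\<Sum>i=1..k. p i)) * (\<Sum>i=1..k. p i * s i))
        \<le> (1 / (\<Sum>i=1..k. p i)) * (\<Sum>i=1..k. p i * \<Phi> (s i))"
      using mean(2) .
    show "(1 / (\<Sum>i=1..k. p i)) * (\<Sum>i=1..k. p i * \<Phi> (s i)) \<le> (\<Sum>j=1..n. lam j * \<phi> (x j))"
      using mean(3) .
  }
qed

end
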